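(* Let $\mathbf{L}$ be a complete residuated lattice on the real unit interval which is rationally closed and satisfies $a\rightarrow\bigvee_{i\in I}b_i=\bigvee_{i\in I}(a\rightarrow b_i)$ for all $a\in[0,1]$ and all families $\{b_i\}_{i\in I}\subseteq[0,1]$. Then for every theory $\Sigma$ and every formula $A\Rightarrow B$, $$|A\Rightarrow B|_\Sigma=||A\Rightarrow B||_\Sigma .$$ In particular, this equality holds when $\mathbf{L}$ is the standard Łukasiewicz algebra or the standard product (Goguen) algebra.
   Context: A complete residuated lattice on the real unit interval is $\mathbf{L}=\langle[0,1],\wedge,\vee,\otimes,\rightarrow,0,1\rangle$ where $\wedge,\vee$ are minimum and maximum, $\langle[0,1],\otimes,1\rangle$ is a commutative monoid, and $a\otimes b\le c$ iff $a\le b\rightarrow c$. $\mathbf{L}$ is rationally closed if $a\otimes b$ and $a\rightarrow b$ are rational whenever $a,b\in[0,1]_\mathbb{Q}$ ($[0,1]_\mathbb{Q}$ = rationals in $[0,1]$). The standard Łukasiewicz algebra has $a\otimes b=\max\{0,a+b-1\}$, $a\rightarrow b=\min\{1,1-a+b\}$; the standard product algebra has $a\otimes b=ab$, $a\rightarrow b=1$ if $a\le b$ and $b/a$ otherwise. An $\mathbf{L}$-set in a set $U$ is a map $U\to[0,1]$; it is finite if $\{u: A(u)>0\}$ is finite and rational if all its values are rational. Unions/intersections are pointwise sup/inf, $(c\otimes A)(u)=c\otimes A(u)$, $A\subseteq B$ means $A(u)\le B(u)$ for all $u$, and $S(A,B)=\bigwedge_{u\in U}(A(u)\rightarrow B(u))$.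 Fix a denumerable set $\mathrm{Var}$ of propositional variables. A formula is an expression $A\Rightarrow B$ where $A,B$ are finite rational $\mathbf{L}$-sets in $\mathrm{Var}$ (encoding $((\overline{a_1}\Rightarrow p_1)\&\cdots\&(\overline{a_m}\Rightarrow p_m))\Rightarrow((\overline{b_1}\Rightarrow q_1)\&\cdots)$ with $A(p_i)=a_i$, $B(q_j)=b_j$). An evaluation is a map $e:\mathrm{Var}\to[0,1]$ (an $\mathbf{L}$-set in $\mathrm{Var}$), and $||A\Rightarrow B||_e=S(A,e)\rightarrow S(B,e)$. A theory is a set $\Sigma$ of formulas; $e$ is a model of $\Sigma$ if $||\varphi||_e=1$ for all $\varphi\in\Sigma$; $||A\Rightarrow B||_\Sigma=\bigwedge\{||A\Rightarrow B||_e: e\text{ a model of }\Sigma\}$. Deductive system: axioms are all formulas $A\cup B\Rightarrow B$; rules are (Cut) from $A\Rightarrow B$ and $B\cup C\Rightarrow D$ infer $A\cup C\Rightarrow D$, and (Mul) from $A\Rightarrow B$ infer $c\otimes A\Rightarrow c\otimes B$ for $c\in[0,1]_\mathbb{Q}$ (all of $A,B,C,D$ finite rational). A proof of $A\Rightarrow B$ from $\Sigma$ is a finite sequence of formulas ending with $A\Rightarrow B$, each an axiom, a member of $\Sigma$, or obtained from earlier ones by one application of (Cut) or (Mul); write $\Sigma\vdash A\Rightarrow B$. The provability degree is $|A\Rightarrow B|_\Sigma=\bigvee\{c\in[0,1]_\mathbb{Q}:\Sigma\vdash A\Rightarrow c\otimes B\}$. *)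

theory Defs
  imports Complex_Main "HOL-Library.Countable" "HOL-Library.Infinite_Typeclass"
begin

typedef unit_interval = "{0..1::real}"
  morphisms real_of_unit unit_of_real
  by (rule exI[of _ 0]) simp

setup_lifting type_definition_unit_interval

instantiation unit_interval :: linorder
begin

lift_definition less_eq_unit_interval :: "unit_interval \<Rightarrow> unit_interval \<Rightarrow> bool" is "(\<le>)" .

lift_definition less_unit_interval :: "unit_interval \<Rightarrow> unit_interval \<Rightarrow> bool" is "(<)" .

instance by standard (transfer; force)+

end

instantiation unit_interval :: zero_neq_one
begin

lift_definition zero_unit_interval :: unit_interval is 0 by simp

lift_definition one_unit_interval :: unit_interval is 1 by simp

instance by standard (transfer; simp)

end

instantiation unit_interval :: complete_linorder
begin

lift_definition inf_unit_interval :: "unit_interval \<Rightarrow> unit_interval \<Rightarrow> unit_interval" is min by auto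

lift_definition sup_unit_interval :: "unit_interval \<Rightarrow> unit_interval \<Rightarrow> unit_interval" is max by auto

definition bot_unit_interval :: unit_interval where "bot_unit_interval = 0"

definition top_unit_interval :: unit_interval where "top_unit_interval = 1"

text \<open>On \<^typ>\<open>real\<close>, \<^const>\<open>Sup\<close> and \<^const>\<open>Inf\<close> are unspecified for the empty set, hence the
  explicit case distinction.\<close>

lift_definition Sup_unit_interval :: "unit_interval set \<Rightarrow> unit_interval"
  is "\<lambda>X. if X = {} then 0 else Sup X"
  by (auto intro: cSup_least intro!: cSup_upper2 bdd_aboveI[of _ 1])

lift_definition Inf_unit_interval :: "unit_interval set \<Rightarrow> unit_interval"
  is "\<lambda>X. if X = {} then 1 else Inf X"
  by (auto intro: cInf_greatest intro!: cInf_lower2 bdd_belowI[of _ 0])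

instance
proof
  fix x z :: unit_interval and A :: "unit_interval set"
  show "x \<in> A \<Longrightarrow> Inf A \<le> x"
    by transfer (auto intro!: cInf_lower bdd_belowI[of _ 0])
  show "(\<And>x. x \<in> A \<Longrightarrow> z \<le> x) \<Longrightarrow> z \<le> Inf A"
    by transfer (auto intro!: cInf_greatest)
  show "x \<in> A \<Longrightarrow> x \<le> Sup A"
    by transfer (auto intro!: cSup_upper bdd_aboveI[of _ 1])
  show "(\<And>x. x \<in> A \<Longrightarrow> x \<le> z) \<Longrightarrow> Sup A \<le> z"
    by transfer (auto intro!: cSup_least)
  show "Inf {} = (top :: unit_interval)"
    unfolding top_unit_interval_def by transfer simp
  show "Sup {} = (bot :: unit_interval)"
    unfolding bot_unit_interval_def by transfer simp
qed (transfer; simp)+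

end

definition rational :: "unit_interval \<Rightarrow> bool" where
  "rational a \<longleftrightarrow> real_of_unit a \<in> \<rat>"

text \<open>The lattice reduct is \<^typ>\<open>unit_interval\<close> itself, so a structure is determined by its
  multiplication and residuum.\<close>

type_synonym binop = "unit_interval \<Rightarrow> unit_interval \<Rightarrow> unit_interval"

definition complete_residuated_lattice :: "binop \<Rightarrow> binop \<Rightarrow> bool" where
  "complete_residuated_lattice tensor imp \<longleftrightarrow>
     comm_monoid tensor 1 \<and> (\<forall>a b c. tensor a b \<le> c \<longleftrightarrow> a \<le> imp b c)"

definition rationally_closed :: "binop \<Rightarrow> binop \<Rightarrow> bool" where
  "rationally_closed tensor imp \<longleftrightarrow>
     (\<forall>a b. rational a \<longrightarrow> rational b \<longrightarrow> rational (tensor a b) \<and> rational (imp a b))"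

text \<open>Families are nonempty: for the empty family the condition would read
  \<open>a \<rightarrow> 0 = 0\<close> for all \<open>a\<close>, which fails in every residuated lattice at \<open>a = 0\<close>.\<close>

definition residuum_preserves_Sup :: "binop \<Rightarrow> bool" where
  "residuum_preserves_Sup imp \<longleftrightarrow>
     (\<forall>a X. X \<noteq> {} \<longrightarrow> imp a (Sup X) = (SUP b\<in>X. imp a b))"

lift_definition lukasiewicz_tensor :: binop is "\<lambda>a b. max 0 (a + b - 1)"
  by auto

lift_definition lukasiewicz_imp :: binop is "\<lambda>a b. min 1 (1 - a + b)"
  by auto

lift_definition product_tensor :: binop is "\<lambda>a b. a * b"
  by (auto intro: mult_le_one)

lift_definition product_imp :: binop is "\<lambda>a b. if a \<le> b then 1 else b / a"
  by (auto simp: divide_simps)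

text \<open>Inclusion and union of \<open>L\<close>-sets are \<^const>\<open>less_eq\<close> and \<^const>\<open>sup\<close> on functions.\<close>

type_synonym 'u lset = "'u \<Rightarrow> unit_interval"

definition finite_lset :: "'u lset \<Rightarrow> bool" where
  "finite_lset A \<longleftrightarrow> finite {u. A u > 0}"

definition rational_lset :: "'u lset \<Rightarrow> bool" where
  "rational_lset A \<longleftrightarrow> (\<forall>u. rational (A u))"

definition fin_rat :: "'u lset set" where
  "fin_rat = {A. finite_lset A \<and> rational_lset A}"

definition scale :: "binop \<Rightarrow> unit_interval \<Rightarrow> 'u lset \<Rightarrow> 'u lset" where
  "scale tensor c A = (\<lambda>u. tensor c (A u))"

definition subsethood :: "binop \<Rightarrow> 'u lset \<Rightarrow> 'u lset \<Rightarrow> unit_interval" where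
  "subsethood imp A B = (INF u. imp (A u) (B u))"

datatype 'v formula = Imp "'v lset" "'v lset" (infix \<open>\<Rrightarrow>\<close> 55)

definition formulas :: "'v formula set" where
  "formulas = {A \<Rrightarrow> B | A B. A \<in> fin_rat \<and> B \<in> fin_rat}"

fun truth :: "binop \<Rightarrow> 'v lset \<Rightarrow> 'v formula \<Rightarrow> unit_interval" where
  "truth imp e (A \<Rrightarrow> B) = imp (subsethood imp A e) (subsethood imp B e)"

definition models :: "binop \<Rightarrow> 'v formula set \<Rightarrow> 'v lset set" where
  "models imp \<Sigma> = {e. \<forall>\<phi>\<in>\<Sigma>. truth imp e \<phi> = 1}"

definition entailment_degree :: "binop \<Rightarrow> 'v formula set \<Rightarrow> 'v formula \<Rightarrow> unit_interval" where
  "entailment_degree imp \<Sigma> \<phi> = (INF e\<in>models imp \<Sigma>. truth imp e \<phi>)"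

definition axioms :: "'v formula set" where
  "axioms = {sup A B \<Rrightarrow> B | A B. A \<in> fin_rat \<and> B \<in> fin_rat}"

definition cut_rule :: "'v formula \<Rightarrow> 'v formula \<Rightarrow> 'v formula \<Rightarrow> bool" where
  "cut_rule \<phi> \<psi> \<chi> \<longleftrightarrow>
     (\<exists>A\<in>fin_rat. \<exists>B\<in>fin_rat. \<exists>C\<in>fin_rat. \<exists>D\<in>fin_rat.
        \<phi> = (A \<Rrightarrow> B) \<and> \<psi> = (sup B C \<Rrightarrow> D) \<and> \<chi> = (sup A C \<Rrightarrow> D))"

definition mul_rule :: "binop \<Rightarrow> 'v formula \<Rightarrow> 'v formula \<Rightarrow> bool" where
  "mul_rule tensor \<phi> \<chi> \<longleftrightarrow>
     (\<exists>A\<in>fin_rat. \<exists>B\<in>fin_rat. \<exists>c. rational c \<and>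
        \<phi> = (A \<Rrightarrow> B) \<and> \<chi> = (scale tensor c A \<Rrightarrow> scale tensor c B))"

definition is_proof :: "binop \<Rightarrow> 'v formula set \<Rightarrow> 'v formula list \<Rightarrow> bool" where
  "is_proof tensor \<Sigma> \<phi>s \<longleftrightarrow>
     set \<phi>s \<subseteq> formulas \<and>
     (\<forall>i<length \<phi>s.
        \<phi>s ! i \<in> axioms \<or> \<phi>s ! i \<in> \<Sigma> \<or>
        (\<exists>j<i. \<exists>k<i. cut_rule (\<phi>s ! j) (\<phi>s ! k) (\<phi>s ! i)) \<or>
        (\<exists>j<i. mul_rule tensor (\<phi>s ! j) (\<phi>s ! i)))"

definition provable :: "binop \<Rightarrow> 'v formula set \<Rightarrow> 'v formula \<Rightarrow> bool" where
  "provable tensor \<Sigma> \<phi> \<longleftrightarrow> (\<exists>\<phi>s. is_proof tensor \<Sigma> \<phi>s \<and> \<phi>s \<noteq> [] \<and> last \<phi>s = \<phi>)"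

fun provability_degree :: "binop \<Rightarrow> 'v formula set \<Rightarrow> 'v formula \<Rightarrow> unit_interval" where
  "provability_degree tensor \<Sigma> (A \<Rrightarrow> B) =
     Sup {c. rational c \<and> provable tensor \<Sigma> (A \<Rrightarrow> scale tensor c B)}"

end

theory Submission
  imports Defs
begin

text \<open>
  Fix \<open>\<Sigma>\<close> and \<open>A\<close> and consider the evaluation \<open>e(p) = |A \<Rightarrow> {1/p}|\<^sub>\<Sigma>\<close>, the supremum of all
  rational \<open>c\<close> such that \<open>A \<Rightarrow> {c/p}\<close> is provable. Because the residuum preserves suprema in its
  second argument and formulas have finite support, every rational \<open>d < S(B, e)\<close> admits a proof of
  \<open>A \<Rightarrow> d \<otimes> B\<close>. Hence \<open>S(B, e) \<le> |A \<Rightarrow> B|\<^sub>\<Sigma>\<close>, and applying the same fact to the antecedent of a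
  member of \<open>\<Sigma>\<close>, followed by (Mul), shows that \<open>e\<close> is a model of \<open>\<Sigma>\<close>. Since \<open>S(A, e) = 1\<close>, the truth
  degree of \<open>A \<Rightarrow> B\<close> in \<open>e\<close> is \<open>S(B, e)\<close>, which gives completeness.
\<close>

section \<open>The unit interval\<close>

lemma unit_interval_bounds [simp]: "0 \<le> (a :: unit_interval)" "a \<le> (1 :: unit_interval)"
  by (transfer; simp)+

lemma rational_0 [simp]: "rational 0"
  by (simp add: rational_def zero_unit_interval.rep_eq)

lemma rational_sup: "rational a \<Longrightarrow> rational b \<Longrightarrow> rational (sup a b)"
  by (simp add: rational_def sup_unit_interval.rep_eq max_def)

lemma rational_dense:
  fixes a b :: unit_interval
  assumes "a < b"
  obtains c where "rational c" "a < c" "c < b"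
proof -
  have "real_of_unit a < real_of_unit b"
    using assms by transfer
  then obtain r where r: "r \<in> \<rat>" "real_of_unit a < r" "r < real_of_unit b"
    using Rats_dense_in_real by blast
  have "r \<in> {0..1}"
    using r real_of_unit[of a] real_of_unit[of b] by auto
  then have eq: "real_of_unit (unit_of_real r) = r"
    by (rule unit_of_real_inverse)
  show thesis
    by (rule that[of "unit_of_real r"])
      (use r eq in \<open>simp_all add: rational_def less_unit_interval.rep_eq\<close>)
qed

text \<open>Provability degrees are suprema that need not be attained, so derivations are available
  only strictly below them. Density of the rationals turns such strict bounds into an inequality
  between degrees.\<close>

lemma le_if_rational_less_le:
  fixes a b :: unit_interval
  assumes "\<And>c. rational c \<Longrightarrow> c < a \<Longrightarrow> c \<le> b"
  shows "a \<le> b"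
proof (rule ccontr)
  assume "\<not> a \<le> b"
  then obtain c where "rational c" "b < c" "c < a"
    using rational_dense[of b a] by (metis not_le)
  then show False
    using assms[of c] by simp
qed

section \<open>Finite rational sets\<close>

definition lsingleton :: "unit_interval \<Rightarrow> 'u \<Rightarrow> 'u lset" where
  "lsingleton c p = (\<lambda>u. if u = p then c else 0)"

lemma fin_rat_iff: "A \<in> fin_rat \<longleftrightarrow> finite {u. A u \<noteq> 0} \<and> (\<forall>u. rational (A u))"
proof -
  have "0 < A u \<longleftrightarrow> A u \<noteq> 0" for u
    by (auto simp: less_le)
  then show ?thesis
    by (simp add: fin_rat_def finite_lset_def rational_lset_def)
qed

lemma Imp_in_formulas_iff [simp]: "(A \<Rrightarrow> B) \<in> formulas \<longleftrightarrow> A \<in> fin_rat \<and> B \<in> fin_rat"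
  by (auto simp: formulas_def)

lemma fin_rat_sup [intro]:
  assumes "A \<in> fin_rat" "B \<in> fin_rat"
  shows "sup A B \<in> fin_rat"
proof -
  have "{u. sup A B u \<noteq> 0} \<subseteq> {u. A u \<noteq> 0} \<union> {u. B u \<noteq> 0}"
    by auto
  then show ?thesis
    using assms by (auto simp: fin_rat_iff rational_sup intro: finite_subset)
qed

lemma fin_rat_lsingleton [intro]: "rational c \<Longrightarrow> lsingleton c p \<in> fin_rat"
  by (auto simp: fin_rat_iff lsingleton_def intro: finite_subset[of _ "{p}"])

lemma fin_rat_zero [simp]: "(\<lambda>_. 0) \<in> fin_rat"
  by (simp add: fin_rat_iff)

section \<open>Proofs\<close>

text \<open>Cut has to merge two proofs. Justifications refer to earlier positions only, so those in
  \<open>xs\<close> keep their indices and those in \<open>ys\<close> all shift by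
  \<open>length xs\<close>.\<close>

lemma is_proof_append:
  assumes "is_proof tensor \<Sigma> xs" "is_proof tensor \<Sigma> ys"
  shows "is_proof tensor \<Sigma> (xs @ ys)"
  unfolding is_proof_def
proof (intro conjI allI impI)
  show "set (xs @ ys) \<subseteq> formulas"
    using assms by (simp add: is_proof_def)
next
  fix i
  assume i: "i < length (xs @ ys)"
  let ?zs = "xs @ ys"
  show "?zs ! i \<in> axioms \<or> ?zs ! i \<in> \<Sigma> \<or>
      (\<exists>j<i. \<exists>k<i. cut_rule (?zs ! j) (?zs ! k) (?zs ! i)) \<or>
      (\<exists>j<i. mul_rule tensor (?zs ! j) (?zs ! i))"
  proof (cases "i < length xs")
    case True
    then have "?zs ! j = xs ! j" if "j \<le> i" for j
      using that by (simp add: nth_append)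
    moreover note assms(1)[unfolded is_proof_def, THEN conjunct2, rule_format, OF True]
    ultimately show ?thesis
      by (metis less_imp_le order_refl)
  next
    case False
    define m where "m = i - length xs"
    have m: "m < length ys" "i = length xs + m"
      using False i by (auto simp: m_def)
    have "\<exists>j'<i. ?zs ! j' = ys ! j" if "j < m" for j
      using that m(2) by (intro exI[of _ "length xs + j"]) simp
    moreover have "?zs ! i = ys ! m"
      by (simp add: m(2))
    moreover note assms(2)[unfolded is_proof_def, THEN conjunct2, rule_format, OF m(1)]
    ultimately show ?thesis
      by metis
  qed
qed

lemma is_proof_snoc:
  assumes "is_proof tensor \<Sigma> xs" "\<phi> \<in> formulas"
    and "\<phi> \<in> axioms \<or> \<phi> \<in> \<Sigma> \<or> (\<exists>\<psi>\<in>set xs. \<exists>\<chi>\<in>set xs. cut_rule \<psi> \<chi> \<phi>) \<or>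
      (\<exists>\<psi>\<in>set xs. mul_rule tensor \<psi> \<phi>)"
  shows "is_proof tensor \<Sigma> (xs @ [\<phi>])"
  unfolding is_proof_def
proof (intro conjI allI impI)
  show "set (xs @ [\<phi>]) \<subseteq> formulas"
    using assms by (simp add: is_proof_def)
next
  fix i
  assume i: "i < length (xs @ [\<phi>])"
  let ?zs = "xs @ [\<phi>]"
  show "?zs ! i \<in> axioms \<or> ?zs ! i \<in> \<Sigma> \<or>
      (\<exists>j<i. \<exists>k<i. cut_rule (?zs ! j) (?zs ! k) (?zs ! i)) \<or>
      (\<exists>j<i. mul_rule tensor (?zs ! j) (?zs ! i))"
  proof (cases "i < length xs")
    case True
    then have "?zs ! j = xs ! j" if "j \<le> i" for j
      using that by (simp add: nth_append)
    moreover note assms(1)[unfolded is_proof_def, THEN conjunct2, rule_format, OF True]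
    ultimately show ?thesis
      by (metis less_imp_le order_refl)
  next
    case False
    then have "i = length xs"
      using i by simp
    moreover from this have "\<exists>j<i. ?zs ! j = \<psi>" if "\<psi> \<in> set xs" for \<psi>
      using that by (metis in_set_conv_nth nth_append)
    ultimately show ?thesis
      using assms(3) by (metis nth_append_length)
  qed
qed

lemma provable_assumption:
  assumes "\<phi> \<in> \<Sigma>" "\<phi> \<in> formulas"
  shows "provable tensor \<Sigma> \<phi>"
  unfolding provable_def
  using is_proof_snoc[of tensor \<Sigma> "[]" \<phi>] assms
  by (intro exI[of _ "[\<phi>]"]) (simp add: is_proof_def)

lemma provable_axiom:
  assumes "A \<in> fin_rat" "B \<in> fin_rat"
  shows "provable tensor \<Sigma> (sup A B \<Rrightarrow> B)"
proof -
  have "(sup A B \<Rrightarrow> B) \<in> axioms"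
    using assms by (auto simp: axioms_def)
  moreover have "(sup A B \<Rrightarrow> B) \<in> formulas"
    using assms by auto
  ultimately have "is_proof tensor \<Sigma> ([] @ [sup A B \<Rrightarrow> B])"
    by (intro is_proof_snoc) (auto simp: is_proof_def)
  then show ?thesis
    unfolding provable_def by (intro exI[of _ "[sup A B \<Rrightarrow> B]"]) simp
qed

lemma provable_in_formulas: "provable tensor \<Sigma> \<phi> \<Longrightarrow> \<phi> \<in> formulas"
  unfolding provable_def is_proof_def by (metis last_in_set subsetD)

text \<open>\<open>C \<in> fin_rat\<close> is a separate hypothesis because rationality of
  \<open>sup B C\<close> says nothing about the values of \<open>C\<close> that lie below those of
  \<open>B\<close>.\<close>

lemma provable_cut:
  assumes AB: "provable tensor \<Sigma> (A \<Rrightarrow> B)" and BC: "provable tensor \<Sigma> (sup B C \<Rrightarrow> D)"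
    and C: "C \<in> fin_rat"
  shows "provable tensor \<Sigma> (sup A C \<Rrightarrow> D)"
proof -
  obtain xs where xs: "is_proof tensor \<Sigma> xs" "xs \<noteq> []" "last xs = (A \<Rrightarrow> B)"
    using AB by (auto simp: provable_def)
  obtain ys where ys: "is_proof tensor \<Sigma> ys" "ys \<noteq> []" "last ys = (sup B C \<Rrightarrow> D)"
    using BC by (auto simp: provable_def)
  have fr: "A \<in> fin_rat" "B \<in> fin_rat" "D \<in> fin_rat"
    using AB BC by (auto dest!: provable_in_formulas)
  have "cut_rule (A \<Rrightarrow> B) (sup B C \<Rrightarrow> D) (sup A C \<Rrightarrow> D)"
    using fr C unfolding cut_rule_def by blast
  moreover have "(A \<Rrightarrow> B) \<in> set (xs @ ys)" "(sup B C \<Rrightarrow> D) \<in> set (xs @ ys)"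
    using xs ys last_in_set by fastforce+
  ultimately have "is_proof tensor \<Sigma> ((xs @ ys) @ [sup A C \<Rrightarrow> D])"
    using fr C xs(1) ys(1) by (intro is_proof_snoc is_proof_append) auto
  then show ?thesis
    unfolding provable_def by (intro exI[of _ "(xs @ ys) @ [sup A C \<Rrightarrow> D]"]) simp
qed

text \<open>The scaled sets are assumed to lie in \<open>fin_rat\<close> because
  \<open>tensor\<close> is still an arbitrary operation here, which need not preserve
  rationality.\<close>

lemma provable_mul:
  assumes AB: "provable tensor \<Sigma> (A \<Rrightarrow> B)" and c: "rational c"
    and fr: "scale tensor c A \<in> fin_rat" "scale tensor c B \<in> fin_rat"
  shows "provable tensor \<Sigma> (scale tensor c A \<Rrightarrow> scale tensor c B)"
proof -
  let ?\<phi> = "scale tensor c A \<Rrightarrow> scale tensor c B"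
  obtain xs where xs: "is_proof tensor \<Sigma> xs" "xs \<noteq> []" "last xs = (A \<Rrightarrow> B)"
    using AB by (auto simp: provable_def)
  have "A \<in> fin_rat" "B \<in> fin_rat"
    using AB by (auto dest!: provable_in_formulas)
  then have "mul_rule tensor (A \<Rrightarrow> B) ?\<phi>"
    using c unfolding mul_rule_def by blast
  moreover have "(A \<Rrightarrow> B) \<in> set xs"
    using xs last_in_set by fastforce
  ultimately have "is_proof tensor \<Sigma> (xs @ [?\<phi>])"
    using fr xs(1) by (intro is_proof_snoc) auto
  then show ?thesis
    unfolding provable_def by (intro exI[of _ "xs @ [?\<phi>]"]) simp
qed

section \<open>Derived rules of inference\<close>

lemma provable_subset:
  assumes "A \<in> fin_rat" "B \<in> fin_rat" "B \<le> A"
  shows "provable tensor \<Sigma> (A \<Rrightarrow> B)"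
  using provable_axiom[OF assms(1,2)] assms(3) by (simp add: sup_absorb1)

text \<open>This is Cut with the empty set as side antecedent.\<close>

lemma provable_trans:
  assumes "provable tensor \<Sigma> (A \<Rrightarrow> B)" "provable tensor \<Sigma> (B \<Rrightarrow> C)"
  shows "provable tensor \<Sigma> (A \<Rrightarrow> C)"
proof -
  have "sup X (\<lambda>_. 0) = X" for X :: "'a lset"
    by (rule sup_absorb1) (simp add: le_fun_def)
  then show ?thesis
    using provable_cut[of tensor \<Sigma> A B "\<lambda>_. 0" C] assms by simp
qed

text \<open>Starting from \<open>sup B C \<Rrightarrow> sup B C\<close>, one Cut replaces
  \<open>B\<close> by \<open>A\<close> on the left and a second one replaces \<open>C\<close> by
  \<open>A\<close>; idempotence of \<open>sup\<close> leaves \<open>A\<close> alone.\<close>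

lemma provable_sup:
  assumes AB: "provable tensor \<Sigma> (A \<Rrightarrow> B)" and AC: "provable tensor \<Sigma> (A \<Rrightarrow> C)"
  shows "provable tensor \<Sigma> (A \<Rrightarrow> sup B C)"
proof -
  have fr: "A \<in> fin_rat" "B \<in> fin_rat" "C \<in> fin_rat"
    using AB AC by (auto dest!: provable_in_formulas)
  then have "provable tensor \<Sigma> (sup B C \<Rrightarrow> sup B C)"
    by (intro provable_subset) auto
  then have "provable tensor \<Sigma> (sup C A \<Rrightarrow> sup B C)"
    using provable_cut[OF AB _ fr(3)] by (simp add: sup_commute)
  then show ?thesis
    using provable_cut[OF AC _ fr(1)] by simp
qed

text \<open>Finite support makes \<open>B\<close> a finite union of singletons. The induction adds
  one point at a time to the restriction of \<open>B\<close> to \<open>F\<close>.\<close>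

lemma provable_if_singletons_provable:
  assumes A: "A \<in> fin_rat" and B: "B \<in> fin_rat"
    and single: "\<And>p. provable tensor \<Sigma> (A \<Rrightarrow> lsingleton (B p) p)"
  shows "provable tensor \<Sigma> (A \<Rrightarrow> B)"
proof -
  have "provable tensor \<Sigma> (A \<Rrightarrow> (\<lambda>u. if u \<in> F then B u else 0))" if "finite F" for F
    using that
  proof (induction F)
    case empty
    show ?case
      using A by (intro provable_subset) (auto simp: le_fun_def)
  next
    case (insert p F)
    have "sup (lsingleton (B p) p) (\<lambda>u. if u \<in> F then B u else 0) =
        (\<lambda>u. if u \<in> insert p F then B u else 0)"
      using insert.hyps by (auto simp: fun_eq_iff lsingleton_def sup_absorb1 sup_absorb2)
    then show ?case
      using provable_sup[OF single[of p] insert.IH] by simp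
  qed
  moreover have "finite {u. B u \<noteq> 0}"
    using B by (simp add: fin_rat_iff)
  moreover have "(\<lambda>u. if u \<in> {u. B u \<noteq> 0} then B u else 0) = B"
    by auto
  ultimately show ?thesis
    by metis
qed

section \<open>Residuated lattices on the unit interval\<close>

locale residuated_unit_interval =
  fixes tensor imp :: binop
  assumes residuated: "complete_residuated_lattice tensor imp"
begin

sublocale comm_monoid tensor 1
  using residuated by (simp add: complete_residuated_lattice_def)

lemma adjunction: "tensor a b \<le> c \<longleftrightarrow> a \<le> imp b c"
  using residuated by (simp add: complete_residuated_lattice_def)

lemma imp_eq_1_iff: "imp a b = 1 \<longleftrightarrow> a \<le> b"
  using adjunction[of 1 a b] by (simp add: eq_iff)

lemma le_imp_commute: "a \<le> imp b c \<longleftrightarrow> b \<le> imp a c"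
  by (metis adjunction commute)

lemma imp_mono_right: "b \<le> c \<Longrightarrow> imp a b \<le> imp a c"
  by (meson adjunction order.trans order_refl)

lemma tensor_0_right [simp]: "tensor a 0 = 0"
  using adjunction[of 0 a 0] by (simp add: commute eq_iff)

lemma imp_1_left [simp]: "imp 1 b = b"
  by (metis adjunction eq_iff right_neutral)

lemma le_subsethood_iff: "d \<le> subsethood imp A e \<longleftrightarrow> (\<forall>u. tensor d (A u) \<le> e u)"
  by (simp add: subsethood_def le_INF_iff adjunction)

lemma subsethood_antimono: "A \<le> B \<Longrightarrow> subsethood imp B e \<le> subsethood imp A e"
  unfolding subsethood_def
  by (rule INF_mono) (metis UNIV_I le_fun_def le_imp_commute order.trans order_refl)

lemma subsethood_sup:
  "subsethood imp (sup A B) e = inf (subsethood imp A e) (subsethood imp B e)"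
proof (rule antisym)
  show "subsethood imp (sup A B) e \<le> inf (subsethood imp A e) (subsethood imp B e)"
    by (simp add: subsethood_antimono)
next
  let ?d = "inf (subsethood imp A e) (subsethood imp B e)"
  have "tensor ?d (sup A B u) \<le> e u" for u
  proof -
    have "?d \<le> subsethood imp A e" "?d \<le> subsethood imp B e"
      by simp_all
    \<comment> \<open>With \<open>?d\<close> moved into the residuum, the bounds on
      \<open>A u\<close> and \<open>B u\<close> share a right-hand side and hence bound their
      supremum.\<close>
    then have "A u \<le> imp ?d (e u)" "B u \<le> imp ?d (e u)"
      unfolding le_subsethood_iff by (simp_all add: adjunction le_imp_commute)
    then show ?thesis
      by (simp add: adjunction le_imp_commute)
  qed
  then show "?d \<le> subsethood imp (sup A B) e"
    by (simp add: le_subsethood_iff)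
qed

text \<open>Both sides have the same lower bounds \<open>d\<close>, by associativity of
  \<open>tensor\<close>. This is the semantic counterpart of (Mul), and it lets a factor on the
  consequent be read as a lower bound of a truth degree.\<close>

lemma subsethood_scale:
  "subsethood imp (scale tensor c A) e = imp c (subsethood imp A e)"
proof -
  have "d \<le> subsethood imp (scale tensor c A) e \<longleftrightarrow> d \<le> imp c (subsethood imp A e)" for d
    unfolding adjunction[symmetric] le_subsethood_iff by (simp add: scale_def assoc)
  then show ?thesis
    by (meson antisym order_refl)
qed

lemma truth_eq_1_iff: "truth imp e (A \<Rrightarrow> B) = 1 \<longleftrightarrow> subsethood imp A e \<le> subsethood imp B e"
  by (simp add: imp_eq_1_iff)

section \<open>Soundness\<close>

lemma truth_cut:
  assumes "cut_rule \<phi> \<psi> \<chi>" "truth imp e \<phi> = 1" "truth imp e \<psi> = 1"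
  shows "truth imp e \<chi> = 1"
proof -
  obtain A B C D where [simp]: "\<phi> = (A \<Rrightarrow> B)" "\<psi> = (sup B C \<Rrightarrow> D)" "\<chi> = (sup A C \<Rrightarrow> D)"
    using assms(1) by (auto simp: cut_rule_def)
  have "subsethood imp A e \<le> subsethood imp B e"
    "inf (subsethood imp B e) (subsethood imp C e) \<le> subsethood imp D e"
    using assms(2,3) by (simp_all add: imp_eq_1_iff subsethood_sup)
  then have "inf (subsethood imp A e) (subsethood imp C e) \<le> subsethood imp D e"
    by (meson inf_mono order.trans order_refl)
  then show ?thesis
    by (simp add: imp_eq_1_iff subsethood_sup)
qed

lemma truth_mul: "mul_rule tensor \<phi> \<chi> \<Longrightarrow> truth imp e \<phi> = 1 \<Longrightarrow> truth imp e \<chi> = 1"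
  by (auto simp: mul_rule_def imp_eq_1_iff subsethood_scale intro: imp_mono_right)

lemma truth_axiom: "\<phi> \<in> axioms \<Longrightarrow> truth imp e \<phi> = 1"
  by (auto simp: axioms_def imp_eq_1_iff intro!: subsethood_antimono)

lemma soundness:
  assumes "provable tensor \<Sigma> \<phi>" and e: "e \<in> models imp \<Sigma>"
  shows "truth imp e \<phi> = 1"
proof -
  obtain xs where xs: "is_proof tensor \<Sigma> xs" "xs \<noteq> []" "last xs = \<phi>"
    using assms(1) by (auto simp: provable_def)
  \<comment> \<open>Every entry of the proof has to be covered, by strong induction, since a rule
    may use any earlier entries.\<close>
  have "truth imp e (xs ! i) = 1" if "i < length xs" for i
    using that
  proof (induction i rule: less_induct)
    case (less i)
    then have IH: "truth imp e (xs ! j) = 1" if "j < i" for j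
      using that by simp
    note xs(1)[unfolded is_proof_def, THEN conjunct2, rule_format, OF less.prems]
    then consider "xs ! i \<in> axioms" | "xs ! i \<in> \<Sigma>"
      | j k where "j < i" "k < i" "cut_rule (xs ! j) (xs ! k) (xs ! i)"
      | j where "j < i" "mul_rule tensor (xs ! j) (xs ! i)"
      by blast
    then show ?case
      using IH e by cases (auto simp: models_def intro: truth_axiom truth_cut truth_mul)
  qed
  then show ?thesis
    using xs by (metis diff_less last_conv_nth length_greater_0_conv zero_less_one)
qed

text \<open>Soundness for \<open>A \<Rrightarrow> scale tensor c B\<close> says that S(A,e) is at
  most \<open>imp c\<close> applied to S(B,e); exchanging \<open>c\<close> with S(A,e) makes
  \<open>c\<close> a lower bound of the truth degree.\<close>

lemma provability_le_entailment_degree: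
  "provability_degree tensor \<Sigma> (A \<Rrightarrow> B) \<le> entailment_degree imp \<Sigma> (A \<Rrightarrow> B)"
proof -
  have "c \<le> truth imp e (A \<Rrightarrow> B)"
    if "provable tensor \<Sigma> (A \<Rrightarrow> scale tensor c B)" "e \<in> models imp \<Sigma>" for c e
    using soundness[OF that] le_imp_commute by (simp add: imp_eq_1_iff subsethood_scale)
  then show ?thesis
    by (auto simp: entailment_degree_def simp del: truth.simps intro!: Sup_least INF_greatest)
qed

end

section \<open>The canonical model and completeness\<close>

locale rational_residuated_unit_interval = residuated_unit_interval +
  assumes closed: "rationally_closed tensor imp"
    and preserves_Sup: "residuum_preserves_Sup imp"
begin

lemma fin_rat_scale [intro]:
  assumes "rational c" "A \<in> fin_rat"
  shows "scale tensor c A \<in> fin_rat"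
proof -
  have "{u. scale tensor c A u \<noteq> 0} \<subseteq> {u. A u \<noteq> 0}"
    by (auto simp: scale_def)
  then show ?thesis
    using assms closed
    by (auto simp: fin_rat_iff rationally_closed_def scale_def intro: finite_subset)
qed

definition canonical_model :: "'v formula set \<Rightarrow> 'v lset \<Rightarrow> 'v lset" where
  "canonical_model \<Sigma> A p = Sup {c. rational c \<and> provable tensor \<Sigma> (A \<Rrightarrow> lsingleton c p)}"

text \<open>Weakening \<open>B\<close> to its singleton at \<open>p\<close> puts \<open>B p\<close>
  into the set whose supremum defines the canonical model.\<close>

lemma le_canonical_model:
  assumes "provable tensor \<Sigma> (A \<Rrightarrow> B)"
  shows "B p \<le> canonical_model \<Sigma> A p"
proof -
  have B: "B \<in> fin_rat"
    using assms by (auto dest: provable_in_formulas)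
  then have "rational (B p)"
    by (simp add: fin_rat_iff)
  moreover have "provable tensor \<Sigma> (B \<Rrightarrow> lsingleton (B p) p)"
    using B calculation
    by (intro provable_subset fin_rat_lsingleton) (auto simp: le_fun_def lsingleton_def)
  ultimately show ?thesis
    unfolding canonical_model_def using provable_trans[OF assms] by (auto intro: Sup_upper)
qed

text \<open>The supremum at \<open>p\<close> need not be attained, but the slack in
  \<open>d < S(B, e)\<close> and preservation of suprema yield a provable \<open>c\<close> above
  \<open>scale tensor d B p\<close>. The singletons then combine by finiteness of the
  support.\<close>

lemma provable_scale_if_less_subsethood:
  assumes A: "A \<in> fin_rat" and B: "B \<in> fin_rat" and d: "rational d"
    and less: "d < subsethood imp B (canonical_model \<Sigma> A)"
  shows "provable tensor \<Sigma> (A \<Rrightarrow> scale tensor d B)"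
proof (rule provable_if_singletons_provable)
  show dB: "scale tensor d B \<in> fin_rat"
    using B d by blast
  fix p
  define X where "X = {c. rational c \<and> provable tensor \<Sigma> (A \<Rrightarrow> lsingleton c p)}"
  \<comment> \<open>Preservation of suprema is available for nonempty families only.\<close>
  have "0 \<in> X"
    using A by (auto simp: X_def lsingleton_def le_fun_def intro!: provable_subset)
  then have "imp (B p) (Sup X) = (SUP c\<in>X. imp (B p) c)"
    using preserves_Sup by (auto simp: residuum_preserves_Sup_def)
  moreover have "d < imp (B p) (Sup X)"
    using less unfolding subsethood_def X_def canonical_model_def
    by (rule less_le_trans) (auto intro: INF_lower)
  ultimately obtain c where c: "c \<in> X" "d < imp (B p) c"
    by (auto simp: less_SUP_iff)
  then have "scale tensor d B p \<le> c"
    by (simp add: scale_def adjunction)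
  then have "provable tensor \<Sigma> (lsingleton c p \<Rrightarrow> lsingleton (scale tensor d B p) p)"
    using c dB
    by (intro provable_subset fin_rat_lsingleton)
      (auto simp: X_def fin_rat_iff lsingleton_def le_fun_def)
  then show "provable tensor \<Sigma> (A \<Rrightarrow> lsingleton (scale tensor d B p) p)"
    using c provable_trans by (auto simp: X_def)
qed (rule A)

lemma canonical_model_in_models:
  assumes \<Sigma>: "\<Sigma> \<subseteq> formulas" and A: "A \<in> fin_rat"
  shows "canonical_model \<Sigma> A \<in> models imp \<Sigma>"
proof -
  let ?e = "canonical_model \<Sigma> A"
  have "truth imp ?e (C \<Rrightarrow> D) = 1" if CD: "(C \<Rrightarrow> D) \<in> \<Sigma>" for C D
  proof -
    have fr: "C \<in> fin_rat" "D \<in> fin_rat" and pr: "provable tensor \<Sigma> (C \<Rrightarrow> D)"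
      using CD \<Sigma> by (auto intro: provable_assumption)
    have "subsethood imp C ?e \<le> subsethood imp D ?e"
    proof (rule le_if_rational_less_le)
      fix d
      assume d: "rational d" "d < subsethood imp C ?e"
      \<comment> \<open>Since \<open>d\<close> is below S(C,e), \<open>scale tensor d C\<close>
        follows from \<open>A\<close>; chaining with this instance of (Mul) puts
        \<open>scale tensor d D\<close> below the canonical model, which means that \<open>d\<close>
        is at most S(D,e).\<close>
      have "provable tensor \<Sigma> (scale tensor d C \<Rrightarrow> scale tensor d D)"
        using pr d fr by (intro provable_mul) auto
      then have "provable tensor \<Sigma> (A \<Rrightarrow> scale tensor d D)"
        using provable_scale_if_less_subsethood[OF A fr(1) d] provable_trans by blast
      then show "d \<le> subsethood imp D ?e"
        using le_canonical_model by (fastforce simp: le_subsethood_iff scale_def)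
    qed
    then show ?thesis
      by (simp only: truth_eq_1_iff)
  qed
  then show ?thesis
    unfolding models_def by (simp del: truth.simps) (metis formula.exhaust)
qed

lemma entailment_le_provability_degree:
  assumes \<Sigma>: "\<Sigma> \<subseteq> formulas" and A: "A \<in> fin_rat" and B: "B \<in> fin_rat"
  shows "entailment_degree imp \<Sigma> (A \<Rrightarrow> B) \<le> provability_degree tensor \<Sigma> (A \<Rrightarrow> B)"
proof -
  let ?e = "canonical_model \<Sigma> A"
  have "provable tensor \<Sigma> (A \<Rrightarrow> A)"
    using A by (intro provable_subset) auto
  \<comment> \<open>Provability of \<open>A \<Rrightarrow> A\<close> places \<open>A\<close> below
    the canonical model, so the truth degree there reduces to that of the consequent.\<close>
  then have "1 \<le> subsethood imp A ?e"
    unfolding le_subsethood_iff by (simp add: le_canonical_model)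
  then have "subsethood imp A ?e = 1"
    by (simp add: eq_iff)
  then have "truth imp ?e (A \<Rrightarrow> B) = subsethood imp B ?e"
    by simp
  then have "entailment_degree imp \<Sigma> (A \<Rrightarrow> B) \<le> subsethood imp B ?e"
    unfolding entailment_degree_def using canonical_model_in_models[OF \<Sigma> A] by (metis INF_lower)
  also have "\<dots> \<le> provability_degree tensor \<Sigma> (A \<Rrightarrow> B)"
    by (rule le_if_rational_less_le)
      (auto intro: Sup_upper provable_scale_if_less_subsethood[OF A B])
  finally show ?thesis .
qed

theorem completeness:
  assumes "\<Sigma> \<subseteq> formulas" "(A \<Rrightarrow> B) \<in> formulas"
  shows "provability_degree tensor \<Sigma> (A \<Rrightarrow> B) = entailment_degree imp \<Sigma> (A \<Rrightarrow> B)"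
  by (rule antisym[OF provability_le_entailment_degree entailment_le_provability_degree])
    (use assms in simp_all)

end

section \<open>The Lukasiewicz and product algebras\<close>

text \<open>For a monotone residuum, preservation of suprema amounts to left-continuity in the
  second argument. The point 0 is exempt because nothing lies below it.\<close>

lemma residuum_preserves_SupI:
  assumes mono: "\<And>a b c. b \<le> c \<Longrightarrow> imp a b \<le> imp a c"
    and approx: "\<And>a b d. d < imp a b \<Longrightarrow> b = 0 \<or> (\<exists>b'<b. d < imp a b')"
  shows "residuum_preserves_Sup imp"
  unfolding residuum_preserves_Sup_def
proof (intro allI impI antisym)
  fix a and X :: "unit_interval set"
  assume X: "X \<noteq> {}"
  show "(SUP b\<in>X. imp a b) \<le> imp a (Sup X)"
    by (intro SUP_least mono Sup_upper)
  show "imp a (Sup X) \<le> (SUP b\<in>X. imp a b)"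
  proof (rule ccontr)
    assume "\<not> ?thesis"
    then have less: "(SUP b\<in>X. imp a b) < imp a (Sup X)"
      by simp
    obtain b where "b \<in> X" "imp a b > (SUP b\<in>X. imp a b)"
    \<comment> \<open>A nonempty set with supremum 0 contains 0, so there the supremum is attained;
      otherwise \<open>approx\<close> gives a point below \<open>Sup X\<close>, which some element
      of \<open>X\<close> exceeds.\<close>
    proof (cases "Sup X = 0")
      case True
      obtain b where b: "b \<in> X"
        using X by blast
      then have "b = 0"
        using Sup_upper[OF b] True by (simp add: eq_iff)
      then show thesis
        using that b less True by simp
    next
      case False
      then obtain b' where "b' < Sup X" and b': "(SUP b\<in>X. imp a b) < imp a b'"
        using approx[OF less] by blast
      then obtain b where "b \<in> X" "b' < b"
        by (auto simp: less_Sup_iff)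
      then show thesis
        using that b' mono[of b' b a] by fastforce
    qed
    then show False
      by (meson SUP_upper leD)
  qed
qed

lemma lukasiewicz: "rational_residuated_unit_interval lukasiewicz_tensor lukasiewicz_imp"
proof
  show "complete_residuated_lattice lukasiewicz_tensor lukasiewicz_imp"
    unfolding complete_residuated_lattice_def
    by (intro conjI comm_monoid.intro abel_semigroup.intro semigroup.intro
        abel_semigroup_axioms.intro comm_monoid_axioms.intro allI; transfer; auto)
  show "rationally_closed lukasiewicz_tensor lukasiewicz_imp"
    by (simp add: rationally_closed_def rational_def lukasiewicz_tensor.rep_eq
        lukasiewicz_imp.rep_eq max_def min_def)
  show "residuum_preserves_Sup lukasiewicz_imp"
  proof (rule residuum_preserves_SupI)
    show "b \<le> c \<Longrightarrow> lukasiewicz_imp a b \<le> lukasiewicz_imp a c" for a b c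
      by transfer auto
    show "b = 0 \<or> (\<exists>b'<b. d < lukasiewicz_imp a b')" if "d < lukasiewicz_imp a b" for a b d
      using that
    proof transfer
      fix a b d :: real
      assume *: "a \<in> {0..1}" "b \<in> {0..1}" "d \<in> {0..1}" "d < min 1 (1 - a + b)"
      \<comment> \<open>The condition on \<open>b'\<close> is \<open>d + a - 1 < b'\<close>, so the
        midpoint between this threshold and \<open>b\<close> works, cut off at 0 to stay in the
        interval.\<close>
      define b' where "b' = max 0 ((b + (d + a - 1)) / 2)"
      show "b = 0 \<or> (\<exists>b'\<in>{x. x \<in> {0..1}}. b' < b \<and> d < min 1 (1 - a + b'))"
      proof (cases "b = 0")
        case False
        then have "b' \<in> {0..1}" "b' < b" "d < min 1 (1 - a + b')"
          using * by (auto simp: b'_def max_def field_simps split: if_splits)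
        then show ?thesis
          by auto
      qed simp
    qed
  qed
qed

lemma product: "rational_residuated_unit_interval product_tensor product_imp"
proof
  show "complete_residuated_lattice product_tensor product_imp"
    unfolding complete_residuated_lattice_def
  proof (intro conjI comm_monoid.intro abel_semigroup.intro semigroup.intro
      abel_semigroup_axioms.intro comm_monoid_axioms.intro allI)
    show "product_tensor a b \<le> c \<longleftrightarrow> a \<le> product_imp b c" for a b c
    proof transfer
      fix a b c :: real
      assume *: "a \<in> {0..1}" "b \<in> {0..1}" "c \<in> {0..1}"
      then have "a * b \<le> b"
        by (simp add: mult_left_le_one_le)
      then show "a * b \<le> c \<longleftrightarrow> a \<le> (if b \<le> c then 1 else c / b)"
        using * by (auto simp: field_simps)
    qed
  qed (transfer; simp)+
  show "rationally_closed product_tensor product_imp"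
    by (simp add: rationally_closed_def rational_def product_tensor.rep_eq product_imp.rep_eq)
  show "residuum_preserves_Sup product_imp"
  proof (rule residuum_preserves_SupI)
    show "b \<le> c \<Longrightarrow> product_imp a b \<le> product_imp a c" for a b c
      by transfer (auto simp: divide_right_mono divide_le_eq_1)
    show "b = 0 \<or> (\<exists>b'<b. d < product_imp a b')" if "d < product_imp a b" for a b d
      using that
    proof transfer
      fix a b d :: real
      assume *: "a \<in> {0..1}" "b \<in> {0..1}" "d \<in> {0..1}" "d < (if a \<le> b then 1 else b / a)"
      show "b = 0 \<or> (\<exists>b'\<in>{x. x \<in> {0..1}}. b' < b \<and> d < (if a \<le> b' then 1 else b' / a))"
      proof (cases "b = 0")
        case False
        \<comment> \<open>For \<open>a > 0\<close> the threshold is \<open>d * a\<close>, since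
          \<open>d < b' / a\<close> means \<open>d * a < b'\<close>; the witness below is the
          midpoint of \<open>b\<close> and \<open>d * a\<close>. For \<open>a = 0\<close> the
          residuum is constantly 1 and \<open>d < 1\<close> suffices.\<close>
        have "d * a < b \<or> a = 0"
        proof (cases "a \<le> b")
          case True
          then have "d * a < 1 * a" if "a \<noteq> 0"
            using * that by (intro mult_strict_right_mono) auto
          then show ?thesis
            using True by linarith
        next
          case False
          then show ?thesis
            using * by (auto simp: field_simps)
        qed
        moreover have "d < 1"
          using * by (cases "d = 1") (auto simp: field_simps split: if_splits)
        moreover have "0 \<le> d * a"
          using * by simp
        ultimately show ?thesis
          using * False
          by (intro disjI2 bexI[of _ "(b + d * a) / 2"], cases "a = 0")
            (auto simp: pos_less_divide_eq mult.commute)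
      qed simp
    qed
  qed
qed

theorem theorem1:
  shows "(\<forall>tensor imp.
            complete_residuated_lattice tensor imp \<and> rationally_closed tensor imp \<and>
            residuum_preserves_Sup imp \<longrightarrow>
            (\<forall>(\<Sigma> :: ('v :: {countable, infinite}) formula set) A B.
               \<Sigma> \<subseteq> formulas \<and> (A \<Rrightarrow> B) \<in> formulas \<longrightarrow>
               provability_degree tensor \<Sigma> (A \<Rrightarrow> B) = entailment_degree imp \<Sigma> (A \<Rrightarrow> B))) \<and>
         (\<forall>(\<Sigma> :: 'v formula set) A B.
            \<Sigma> \<subseteq> formulas \<and> (A \<Rrightarrow> B) \<in> formulas \<longrightarrow>
            provability_degree lukasiewicz_tensor \<Sigma> (A \<Rrightarrow> B) =
            entailment_degree lukasiewicz_imp \<Sigma> (A \<Rrightarrow> B)) \<and>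
         (\<forall>(\<Sigma> :: 'v formula set) A B.
            \<Sigma> \<subseteq> formulas \<and> (A \<Rrightarrow> B) \<in> formulas \<longrightarrow>
            provability_degree product_tensor \<Sigma> (A \<Rrightarrow> B) =
            entailment_degree product_imp \<Sigma> (A \<Rrightarrow> B))"
  by (intro conjI allI impI; elim conjE; rule rational_residuated_unit_interval.completeness)
    (auto intro: lukasiewicz product rational_residuated_unit_interval.intro
      residuated_unit_interval.intro rational_residuated_unit_interval_axioms.intro
      simp del: Imp_in_formulas_iff)

end
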